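(* Let $P$ and $Q$ be two polynomials in one variable with complex coefficients. Then the polynomial $P(z)Q(w)-1\in\mathbb{C}[z,w]$ is reducible if and only if $$P(z)=P_1(z)^d\qquad\text{and}\qquad Q(w)=Q_1(w)^d$$ for some integer $d>1$ and some polynomials $P_1(z)$ and $Q_1(w)$.
   Context: Here $z$ and $w$ are independent variables, $P_1$ and $Q_1$ are polynomials in one variable with complex coefficients, and a polynomial in $\mathbb{C}[z,w]$ is called reducible if it is a product of two non-constant polynomials in $\mathbb{C}[z,w]$.
   Formalization: P and Q are assumed non-constant; for constant P or Q the stated equivalence fails, e.g. P = 1, Q = w^2 + w gives the reducible polynomial w^2 + w − 1 although Q is not a d-th power with d > 1. *)

theory Defs
  imports "HOL-Computational_Algebra.Polynomial" Complex_Main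
begin

text \<open>
  The ring \<open>\<complex>[z,w]\<close> is represented as \<open>\<complex>[w][z]\<close>: the outer variable of \<^typ>\<open>complex poly poly\<close>
  is \<open>z\<close>, the inner one (that of the coefficients) is \<open>w\<close>.
\<close>

definition in_z :: "complex poly \<Rightarrow> complex poly poly" where
  "in_z P = map_poly (\<lambda>c. [:c:]) P"

definition in_w :: "complex poly \<Rightarrow> complex poly poly" where
  "in_w Q = [:Q:]"

definition eval2 :: "complex poly poly \<Rightarrow> complex \<Rightarrow> complex \<Rightarrow> complex" where
  "eval2 F z w = poly (poly F [:z:]) w"

lemma eval2_in_z [simp]: "eval2 (in_z P) z w = poly P z"
  by (induction P) (simp_all add: in_z_def eval2_def map_poly_pCons)

lemma eval2_in_w [simp]: "eval2 (in_w Q) z w = poly Q w"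
  by (simp add: in_w_def eval2_def)

text \<open>\<open>degree F = 0\<close> would only say that \<open>F\<close> does not involve \<open>z\<close>.\<close>

definition constant2 :: "complex poly poly \<Rightarrow> bool" where
  "constant2 F \<longleftrightarrow> (\<exists>c. F = [:[:c:]:])"

definition reducible2 :: "complex poly poly \<Rightarrow> bool" where
  "reducible2 F \<longleftrightarrow> (\<exists>G H. \<not> constant2 G \<and> \<not> constant2 H \<and> F = G * H)"

end

theory Submission
  imports Defs "HOL-Computational_Algebra.Fundamental_Theorem_Algebra"
begin

text \<open>
  Suppose \<open>P(z) Q(w) - 1 = G H\<close> with \<open>n = deg P\<close>, \<open>m = deg Q\<close>. At a root \<open>a\<close> of \<open>P\<close> the left-hand side
  is \<open>-1\<close>, so \<open>G(a, w)\<close> is a constant independent of \<open>w\<close>. For fixed \<open>w\<close>, every root \<open>\<zeta>\<close> of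
  \<open>G(\<cdot>, w)\<close> satisfies \<open>P(\<zeta>) = 1 / Q(w)\<close>. Evaluating the resultant of \<open>P\<close> and \<open>G(\<cdot>, w)\<close> over the roots
  of either polynomial therefore shows that the leading coefficient \<open>g\<close> of \<open>G\<close> in \<open>z\<close> satisfies
  \<open>g\<^sup>n = c Q\<^sup>k\<close>, where \<open>k\<close> is the degree of \<open>G\<close> in \<open>z\<close>. Exchanging the variables, the leading
  coefficient \<open>h\<close> in \<open>w\<close> satisfies \<open>h\<^sup>m = c' P\<^sup>l\<close>, where \<open>l\<close> is the degree of \<open>G\<close> in \<open>w\<close>.
  As \<open>deg g \<le> l\<close> and \<open>deg h \<le> k\<close>, comparing degrees gives \<open>k / n = l / m\<close>, and the denominator \<open>d\<close>
  of this fraction divides all root multiplicities of \<open>P\<close> and of \<open>Q\<close>.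
\<close>

section \<open>Evaluation, degrees and exchange of variables\<close>

lemma eval2_mult [simp]: "eval2 (F * G) z w = eval2 F z w * eval2 G z w"
  and eval2_add [simp]: "eval2 (F + G) z w = eval2 F z w + eval2 G z w"
  and eval2_diff [simp]: "eval2 (F - G) z w = eval2 F z w - eval2 G z w"
  and eval2_1 [simp]: "eval2 1 z w = 1"
  and eval2_power [simp]: "eval2 (F ^ n) z w = eval2 F z w ^ n"
  by (simp_all add: eval2_def)

text \<open>Over the integral domain of polynomials in \<open>w\<close>, \<open>F - G\<close> has
  the infinitely many roots \<open>[:z:]\<close>, so it is zero.\<close>

lemma eval2_eqI:
  assumes "\<And>z w. eval2 F z w = eval2 G z w"
  shows "F = G"
proof (rule ccontr)
  assume "F \<noteq> G"
  hence "finite {x. poly (F - G) x = 0}"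
    by (intro poly_roots_finite) auto
  moreover have "poly (F - G) [:z:] = 0" for z
    using assms by (simp add: eval2_def poly_eq_poly_eq_iff[symmetric] fun_eq_iff)
  hence "range (\<lambda>z. [:z:]) \<subseteq> {x. poly (F - G) x = 0}"
    by auto
  ultimately have "finite (range (\<lambda>z::complex. [:z:]))"
    by (rule rev_finite_subset)
  moreover have "inj (\<lambda>z::complex. [:z:])"
    by (simp add: inj_def)
  ultimately show False
    using finite_imageD infinite_UNIV_char_0 by blast
qed

lemma in_z_power: "in_z (P ^ n) = in_z P ^ n"
  and in_w_power: "in_w (P ^ n) = in_w P ^ n"
  by (rule eval2_eqI; simp)+

lemma coeff_in_z: "coeff (in_z P) i = [:coeff P i:]"
  by (simp add: in_z_def coeff_map_poly)

lemma degree_in_z: "degree (in_z P) = degree P"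
  by (simp add: in_z_def degree_map_poly)

text \<open>Subtracting 1 changes only the coefficient of \<open>z ^ 0\<close>, which is not the
  leading one.\<close>

lemma
  assumes "degree P > 0" "Q \<noteq> 0"
  shows degree_separated: "degree (in_z P * in_w Q - 1) = degree P"
    and lead_coeff_separated:
      "lead_coeff (in_z P * in_w Q - 1) = smult (lead_coeff P) Q"
proof -
  have c: "coeff (in_z P * in_w Q - 1) i = smult (coeff P i) Q" if "i > 0" for i
    using that by (simp add: in_w_def coeff_in_z mult.commute[of _ "[:Q:]"])
  show d: "degree (in_z P * in_w Q - 1) = degree P"
  proof (rule antisym)
    show "degree (in_z P * in_w Q - 1) \<le> degree P"
      using assms by (intro degree_le allI impI, subst c) (auto simp: coeff_eq_0)
    show "degree P \<le> degree (in_z P * in_w Q - 1)"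
      using assms by (intro le_degree, subst c) auto
  qed
  show "lead_coeff (in_z P * in_w Q - 1) = smult (lead_coeff P) Q"
    unfolding d using assms(1) by (rule c)
qed

text \<open>The evaluation identity transports factorizations; the coefficient identity gives access
  to degrees in the other variable.\<close>

lemma exchange_variables:
  "\<exists>G'. (\<forall>z w. eval2 G' z w = eval2 G w z) \<and>
        (\<forall>i j. coeff (coeff G' i) j = coeff (coeff G j) i)"
proof (induction G)
  case 0
  show ?case by (intro exI[of _ 0]) (simp add: eval2_def)
next
  case (pCons a G)
  then obtain G' where G': "\<And>z w. eval2 G' z w = eval2 G w z"
    "\<And>i j. coeff (coeff G' i) j = coeff (coeff G j) i"
    by blast
  have "eval2 (in_z a + in_w [:0, 1:] * G') z w = eval2 (pCons a G) w z" for z w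
    by (simp add: G') (simp add: eval2_def)
  moreover have "coeff (coeff (in_z a + in_w [:0, 1:] * G') i) j = coeff (coeff (pCons a G) j) i" for i j
    by (cases j) (simp_all add: coeff_in_z in_w_def G')
  ultimately show ?case by blast
qed

lemma degree_coeff_le_degree_exchanged:
  assumes "\<And>i j. coeff (coeff G' i) j = coeff (coeff G j) i"
  shows "degree (coeff G i) \<le> degree G'"
proof (cases "coeff G i = 0")
  case False
  hence "coeff (coeff G' (degree (coeff G i))) i \<noteq> 0"
    by (simp add: assms)
  thus ?thesis by (intro le_degree) auto
qed simp

section \<open>Resultants and the leading coefficient of a factor\<close>

text \<open>Both sides are the resultant of \<open>A\<close> and \<open>B\<close>, up to sign.\<close>

lemma prod_over_roots_exchange:
  fixes A B :: "complex poly"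
  assumes A: "A = smult p (\<Prod>i<m. [:- a i, 1:])" and B: "B = smult g (\<Prod>j<k. [:- b j, 1:])"
  shows "p ^ k * (\<Prod>i<m. poly B (a i)) = (- 1) ^ (m * k) * g ^ m * (\<Prod>j<k. poly A (b j))"
proof -
  have "(\<Prod>i<m. poly B (a i)) = g ^ m * (\<Prod>i<m. \<Prod>j<k. a i - b j)"
    by (simp add: B poly_prod prod.distrib)
  also have "(\<Prod>i<m. \<Prod>j<k. a i - b j) = (\<Prod>j<k. \<Prod>i<m. (- 1) * (b j - a i))"
    by (subst prod.swap) simp
  also have "\<dots> = (- 1) ^ (m * k) * (\<Prod>j<k. \<Prod>i<m. b j - a i)"
    by (subst prod.distrib)+ (simp add: power_mult)
  finally show ?thesis
    by (simp add: A poly_prod prod.distrib mult_ac)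
qed

lemma lead_coeff_factor_power:
  assumes GH: "in_z P * in_w Q - 1 = G * H" and P: "degree P > 0" and Q: "Q \<noteq> 0"
  obtains c where "c \<noteq> 0" and "lead_coeff G ^ degree P = smult c (Q ^ degree G)"
proof -
  define n k p g where "n = degree P" "k = degree G" "p = lead_coeff P" "g = lead_coeff G"
  note defs = this
  have p: "p \<noteq> 0" using P by (auto simp: defs)
  \<comment> \<open>Thus \<open>g\<close> divides a nonzero multiple of \<open>Q\<close> and can
    vanish only at roots of \<open>Q\<close>.\<close>
  have lead: "g * lead_coeff H = smult p Q"
    using lead_coeff_separated[OF P Q] by (simp add: GH lead_coeff_mult defs)
  obtain a where a: "P = smult p (\<Prod>i<n. [:- a i, 1:])"
    using complex_poly_decompose'[of P] unfolding defs by metis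
  have root: "poly P (a i) = 0" if "i < n" for i
    by (subst a) (use that in \<open>auto simp: poly_prod\<close>)
  have "\<exists>u. u \<noteq> 0 \<and> (\<forall>w. eval2 G (a i) w = u)" if "i < n" for i
  proof -
    have "eval2 G (a i) w * eval2 H (a i) w = -1" for w
      using root[OF that] arg_cong[OF GH, of "\<lambda>F. eval2 F (a i) w"] by simp
    hence "poly G [:a i:] * poly H [:a i:] = [:-1:]"
      by (simp add: eval2_def poly_eq_poly_eq_iff[symmetric] fun_eq_iff)
    hence "poly G [:a i:] dvd [:-1:]" by (metis dvd_triv_left)
    hence "is_unit (poly G [:a i:])"
      by (rule dvd_trans) (simp add: is_unit_const_poly_iff)
    then obtain u where "u dvd 1" "poly G [:a i:] = [:u:]"
      by (auto simp: is_unit_poly_iff)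
    moreover have "u \<noteq> 0" using calculation(1) by auto
    ultimately show ?thesis by (auto simp: eval2_def)
  qed
  then obtain u where u: "\<And>i. i < n \<Longrightarrow> u i \<noteq> 0" "\<And>i w. i < n \<Longrightarrow> eval2 G (a i) w = u i"
    by metis
  define c where "c = (- 1) ^ (n * k) * p ^ k * (\<Prod>i<n. u i)"
  have c: "c \<noteq> 0" using p u(1) by (auto simp: c_def)
  have "poly (g ^ n) w = poly (smult c (Q ^ k)) w" if w: "poly Q w \<noteq> 0" for w
  proof -
    \<comment> \<open>\<open>B\<close> is G(\<cdot>, w). Since \<open>g\<close> does not vanish at
      \<open>w\<close>, specialization preserves the degree \<open>k\<close>.\<close>
    define B where "B = map_poly (\<lambda>q. poly q w) G"
    have poly_B: "poly B z = eval2 G z w" for z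
      unfolding B_def eval2_def by (induction G) (simp_all add: map_poly_pCons)
    have gw: "poly g w \<noteq> 0"
      using arg_cong[OF lead, of "\<lambda>q. poly q w"] p w by auto
    hence "degree B = k"
      unfolding B_def defs by (intro map_poly_degree_eq) simp
    moreover have "lead_coeff B = poly g w"
      using calculation by (simp add: B_def coeff_map_poly defs)
    ultimately obtain b where b: "B = smult (poly g w) (\<Prod>j<k. [:- b j, 1:])"
      using complex_poly_decompose'[of B] by metis
    have Pb: "poly P (b j) * poly Q w = 1" if "j < k" for j
    proof -
      have "poly B (b j) = 0"
        by (subst b) (use that in \<open>auto simp: poly_prod\<close>)
      thus ?thesis
        using arg_cong[OF GH, of "\<lambda>F. eval2 F (b j) w"] by (simp add: poly_B)
    qed
    \<comment> \<open>The factor \<open>poly Q w ^ k\<close> is distributed over the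
      \<open>k\<close> roots \<open>b j\<close>, each pair contributing 1 by
      \<open>Pb\<close>.\<close>
    have "p ^ k * (\<Prod>i<n. u i) * poly Q w ^ k
        = (- 1) ^ (n * k) * poly g w ^ n * ((\<Prod>j<k. poly P (b j)) * (\<Prod>j<k. poly Q w))"
      using prod_over_roots_exchange[OF a b] u(2) by (simp add: poly_B)
    also have "(\<Prod>j<k. poly P (b j)) * (\<Prod>j<k. poly Q w) = 1"
      by (simp add: Pb flip: prod.distrib del: prod_constant)
    finally have "(- 1) ^ (n * k) * (p ^ k * (\<Prod>i<n. u i) * poly Q w ^ k)
        = ((- 1) ^ (n * k) * (- 1) ^ (n * k)) * poly g w ^ n"
      by (simp add: mult_ac)
    also have "(- 1) ^ (n * k) * (- 1) ^ (n * k) = (1 :: complex)"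
      by (simp flip: power_mult_distrib)
    finally show ?thesis by (simp add: c_def mult_ac)
  qed
  \<comment> \<open>The extra factor \<open>Q\<close> covers the excluded points, the roots of
    \<open>Q\<close>.\<close>
  hence "poly ((g ^ n - smult c (Q ^ k)) * Q) w = 0" for w
    by (cases "poly Q w = 0") simp_all
  hence "(g ^ n - smult c (Q ^ k)) * Q = 0"
    using poly_all_0_iff_0 by blast
  hence "g ^ n = smult c (Q ^ k)" using Q by simp
  with c show ?thesis using that by (simp add: defs)
qed

section \<open>Root multiplicities and perfect powers\<close>

text \<open>Divide all multiplicities by \<open>d\<close> and take a \<open>d\<close>-th root of the
  leading coefficient.\<close>

lemma poly_is_power:
  fixes P :: "complex poly"
  assumes "d > 0" and "\<And>x. d dvd order x P"
  shows "\<exists>R. P = R ^ d"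
proof -
  obtain s where s: "s ^ d = lead_coeff P"
    using nth_root_exists[OF assms(1)] by blast
  define R where "R = smult s (\<Prod>x | poly P x = 0. [:- x, 1:] ^ (order x P div d))"
  have "R ^ d = smult (lead_coeff P) (\<Prod>x | poly P x = 0. [:- x, 1:] ^ order x P)"
    using assms(2) by (simp add: R_def smult_power s prod_power_distrib flip: power_mult)
  thus ?thesis by (metis complex_poly_decompose)
qed

text \<open>Comparing multiplicities at \<open>x\<close> gives \<open>n dvd k * order x Q\<close>;
  cancelling the gcd leaves a divisor coprime to the cofactor of \<open>k\<close>.\<close>

lemma dvd_order_of_power_eq:
  fixes g Q :: "complex poly"
  assumes "g ^ n = smult c (Q ^ k)" and "c \<noteq> 0" and "Q \<noteq> 0" and "n > 0"
  shows "n div gcd n k dvd order x Q"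
proof -
  have "n * count (proots g) x = k * count (proots Q) x"
    using arg_cong[OF assms(1), of "\<lambda>p. count (proots p) x"] assms(2)
    by (simp add: proots_power)
  hence dvd: "n dvd k * order x Q"
    using assms(3) by (metis count_proots dvd_triv_left)
  have "gcd n k \<noteq> 0" using assms(4) by auto
  then obtain a b where ab: "n = a * gcd n k" "k = b * gcd n k" "coprime a b"
    using gcd_coprime_exists by blast
  have "a * gcd n k dvd (b * order x Q) * gcd n k"
    using dvd ab(1,2) by (metis mult.assoc mult.commute)
  hence "a dvd b * order x Q" 
    using assms(4) by (simp add: mult.commute[of _ "gcd n k"])
  hence "a dvd order x Q" using ab(3) by (simp add: coprime_dvd_mult_right_iff)
  moreover have "n div gcd n k = a"
    using ab(1) \<open>gcd n k \<noteq> 0\<close> by (metis nonzero_mult_div_cancel_right)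
  ultimately show ?thesis by simp
qed

lemma separated_factorD:
  assumes GH: "in_z P * in_w Q - 1 = G * H" and P: "degree P > 0" and Q: "degree Q > 0"
    and G: "\<not> constant2 G"
  shows "degree G > 0" and "degree G * degree Q = degree P * degree (lead_coeff G)"
    and "degree P div gcd (degree P) (degree G) dvd order x Q"
proof -
  have "Q \<noteq> 0" using Q by auto
  obtain c where c: "c \<noteq> 0" "lead_coeff G ^ degree P = smult c (Q ^ degree G)"
    using lead_coeff_factor_power[OF GH P \<open>Q \<noteq> 0\<close>] .
  have "G \<noteq> 0" using G by (auto simp: constant2_def)
  hence deg: "degree P * degree (lead_coeff G) = degree G * degree Q"
    using arg_cong[OF c(2), of degree] c(1) \<open>Q \<noteq> 0\<close> 
    by (simp add: degree_power_eq)
  show "degree G > 0"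
  proof (rule ccontr)
    assume "\<not> degree G > 0"
    then obtain g where g: "G = [:g:]" by (auto elim: degree_eq_zeroE)
    \<comment> \<open>With \<open>degree G = 0\<close>, the degree identity reads
      \<open>degree P * degree g = 0\<close>.\<close>
    hence "degree g = 0" using deg P by simp
    thus False using G g by (auto simp: constant2_def elim: degree_eq_zeroE)
  qed
  show "degree G * degree Q = degree P * degree (lead_coeff G)"
    by (simp add: deg)
  show "degree P div gcd (degree P) (degree G) dvd order x Q"
    using dvd_order_of_power_eq[OF c(2,1) \<open>Q \<noteq> 0\<close> P] .
qed

section \<open>The reducibility criterion\<close>

theorem theorem1:
  fixes P Q :: "complex poly"
  assumes "degree P > 0" and "degree Q > 0"
  shows "reducible2 (in_z P * in_w Q - 1) \<longleftrightarrow>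
    (\<exists>d::nat. d > 1 \<and> (\<exists>P1 Q1 :: complex poly. P = P1 ^ d \<and> Q = Q1 ^ d))"
proof
  assume "\<exists>d::nat. d > 1 \<and> (\<exists>P1 Q1 :: complex poly. P = P1 ^ d \<and> Q = Q1 ^ d)"
  then obtain d P1 Q1 where d: "d > 1" and PQ: "P = P1 ^ d" "Q = Q1 ^ d"
    by blast
  define X where "X = in_z P1 * in_w Q1"
  have pos: "degree P1 > 0" "Q1 \<noteq> 0"
    using assms degree_power_le[of P1 d] d by (auto simp: PQ power_0_left intro: Nat.gr0I)
  have nonzero: "P1 \<noteq> 0" using pos by auto
  have "in_z P * in_w Q - 1 = X ^ d - 1"
    by (simp add: X_def PQ in_z_power in_w_power power_mult_distrib)
  also have "\<dots> = (X - 1) * (\<Sum>i<d. X ^ i)"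
    by (rule power_diff_1_eq)
  finally have F: "in_z P * in_w Q - 1 = (X - 1) * (\<Sum>i<d. X ^ i)" .
  have degX: "degree (X - 1) = degree P1"
    unfolding X_def using pos by (rule degree_separated)
  have degF: "degree ((X - 1) * (\<Sum>i<d. X ^ i)) = d * degree P1"
    using degree_separated[OF assms(1), of Q] pos nonzero
    by (simp add: PQ degree_power_eq flip: F)
  \<comment> \<open>The first factor has degree \<open>degree P1\<close> in \<open>z\<close>, less
    than the total \<open>d * degree P1\<close>, so the second also involves
    \<open>z\<close>.\<close>
  have "degree (X - 1) + degree (\<Sum>i<d. X ^ i) \<ge> d * degree P1"
    using degree_mult_le[of "X - 1" "\<Sum>i<d. X ^ i"] degF by simp
  moreover have "d * degree P1 > 1 * degree P1"
    using d pos by (intro mult_strict_right_mono) auto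
  ultimately have "degree (\<Sum>i<d. X ^ i) > 0" using degX by linarith
  with degX pos have "\<not> constant2 (X - 1)" "\<not> constant2 (\<Sum>i<d. X ^ i)"
    by (auto simp: constant2_def)
  thus "reducible2 (in_z P * in_w Q - 1)"
    unfolding reducible2_def using F by blast
next
  assume "reducible2 (in_z P * in_w Q - 1)"
  then obtain G H where G: "\<not> constant2 G" and H: "\<not> constant2 H"
    and GH: "in_z P * in_w Q - 1 = G * H"
    by (auto simp: reducible2_def)
  obtain G' where G': "\<And>z w. eval2 G' z w = eval2 G w z"
    "\<And>i j. coeff (coeff G' i) j = coeff (coeff G j) i"
    using exchange_variables by blast
  obtain H' where H': "\<And>z w. eval2 H' z w = eval2 H w z"
    using exchange_variables by blast
  have GH': "in_z Q * in_w P - 1 = G' * H'"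
  proof (rule eval2_eqI)
    fix z w
    show "eval2 (in_z Q * in_w P - 1) z w = eval2 (G' * H') z w"
      using arg_cong[OF GH, of "\<lambda>F. eval2 F w z"] by (simp add: G' H' mult.commute)
  qed
  have "G = [:[:c:]:]" if "G' = [:[:c:]:]" for c
  proof (rule eval2_eqI)
    show "eval2 G z w = eval2 [:[:c:]:] z w" for z w
      using G'(1)[of w z] by (simp add: that eval2_def)
  qed
  with G have nonconst: "\<not> constant2 G'" by (auto simp: constant2_def)
  define n m k l where "n = degree P" "m = degree Q" "k = degree G" "l = degree G'"
  note defs = this
  have HG: "in_z P * in_w Q - 1 = H * G" using GH by (simp add: mult.commute)
  note factG = separated_factorD[OF GH assms G]
  note factG' = separated_factorD[OF GH' assms(2,1) nonconst]
  \<comment> \<open>Each inequality bounds the degree of the leading coefficient in one variable by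
    the degree of \<open>G\<close> in the other.\<close>
  have "k * m = n * l"
  proof (rule antisym)
    show "k * m \<le> n * l"
      using degree_coeff_le_degree_exchanged[OF G'(2)] by (simp add: factG(2) defs)
    have "l * n \<le> m * k"
      using degree_coeff_le_degree_exchanged[OF G'(2)[symmetric]] by (simp add: factG'(2) defs)
    thus "n * l \<le> k * m" by (simp add: mult.commute)
  qed
  \<comment> \<open>The cofactor must involve \<open>z\<close> too; this makes \<open>k < n\<close>
    strict and hence \<open>d > 1\<close>.\<close>
  have "0 < degree H"
    by (rule separated_factorD(1)[OF HG assms H])
  moreover have "n = k + degree H"
  proof -
    have "G \<noteq> 0" "H \<noteq> 0"
      using factG(1) \<open>0 < degree H\<close> by auto
    moreover have "Q \<noteq> 0" using assms(2) by auto
    ultimately show ?thesis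
      using degree_separated[OF assms(1), of Q] by (simp add: GH degree_mult_eq defs)
  qed
  ultimately have "0 < k" "k < n"
    using factG(1) by (simp_all add: defs)
  define d where "d = n div gcd n k"
  have n: "n = d * gcd n k"
    by (simp add: d_def)
  have "d > 1"
  proof (rule ccontr)
    assume "\<not> d > 1"
    hence "n \<le> gcd n k" using n by (cases d) auto
    also have "\<dots> \<le> k" using \<open>0 < k\<close> by (intro dvd_imp_le) auto
    finally show False using \<open>k < n\<close> by simp
  qed
  \<comment> \<open>The fractions k/n and l/m are equal, so their reduced denominators agree: both
    \<open>n * gcd m l\<close> and \<open>m * gcd n k\<close> equal
    \<open>gcd (n * m) (n * l)\<close>.\<close>
  have "d = m div gcd m l"
  proof -
    have "d * gcd m l * gcd n k = n * gcd m l"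
      using n by (metis mult.assoc mult.commute)
    also have "\<dots> = m * gcd n k"
      using \<open>k * m = n * l\<close> by (metis gcd_mult_distrib_nat mult.commute)
    finally have "d * gcd m l = m"
      using \<open>0 < k\<close> by simp
    moreover have "gcd m l \<noteq> 0" using assms(2) by (simp add: defs)
    ultimately show ?thesis by (metis nonzero_mult_div_cancel_right)
  qed
  have "\<exists>Q1. Q = Q1 ^ d"
    using factG(3) \<open>d > 1\<close> by (intro poly_is_power) (auto simp: d_def defs)
  moreover have "\<exists>P1. P = P1 ^ d"
    using factG'(3) \<open>d > 1\<close> unfolding \<open>d = m div gcd m l\<close>
    by (intro poly_is_power) (auto simp: defs)
  ultimately show "\<exists>d::nat. d > 1 \<and> (\<exists>P1 Q1 :: complex poly. P = P1 ^ d \<and> Q = Q1 ^ d)"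
    using \<open>d > 1\<close> by blast
qed

end
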